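(* Let $A$ be a finite subset of $\mathbb{R}^n$. The following are equivalent: (i) $A$ is a spectral set; (ii) there exists a family $(U(t))_{t\in\mathbb{R}^n}$ of unitary operators on $L^2(A)$, continuous in $t$ and satisfying $U(t+s)=U(t)U(s)$ for all $t,s\in\mathbb{R}^n$, such that $U(a-a')\chi_a=\chi_{a'}$ for all $a,a'\in A$.
   Context: For $\lambda,x\in\mathbb{R}^n$ let $e_\lambda(x)=e^{2\pi i\lambda\cdot x}$. For a finite set $A\subset\mathbb{R}^n$ with $N=\#A$, let $\delta_A=\frac1N\sum_{a\in A}\delta_a$ be the normalized counting measure and $L^2(A):=L^2(\delta_A)$. $A$ is called spectral if there is $\Lambda\subset\mathbb{R}^n$ such that $\{e_\lambda|_A\}_{\lambda\in\Lambda}$ is an orthogonal basis of $L^2(A)$. For $a\in A$, $\chi_a$ is the function on $A$ equal to $1$ at $a$ and $0$ at the other points of $A$. *)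

theory Defs
  imports "HOL-Analysis.Analysis"
begin

definition echar :: "real^'n \<Rightarrow> real^'n \<Rightarrow> complex" where
  "echar l x = exp (2 * complex_of_real pi * \<i> * complex_of_real (l \<bullet> x))"

definition L2 :: "(real^'n) set \<Rightarrow> (real^'n \<Rightarrow> complex) set" where
  "L2 A = {f. \<forall>x. x \<notin> A \<longrightarrow> f x = 0}"

text \<open>Inner product of L^2(delta_A), delta_A the normalized counting measure.\<close>
definition l2inner :: "(real^'n) set \<Rightarrow> (real^'n \<Rightarrow> complex) \<Rightarrow> (real^'n \<Rightarrow> complex) \<Rightarrow> complex" where
  "l2inner A f g = (1 / of_nat (card A)) * (\<Sum>a\<in>A. f a * cnj (g a))"

definition erestr :: "(real^'n) set \<Rightarrow> real^'n \<Rightarrow> real^'n \<Rightarrow> complex" where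
  "erestr A l = (\<lambda>x. if x \<in> A then echar l x else 0)"

definition chi :: "real^'n \<Rightarrow> real^'n \<Rightarrow> complex" where
  "chi a = (\<lambda>x. if x = a then 1 else 0)"

definition spectral :: "(real^'n) set \<Rightarrow> bool" where
  "spectral A \<longleftrightarrow> (\<exists>\<Lambda>.
     (\<forall>l\<in>\<Lambda>. \<forall>m\<in>\<Lambda>. l \<noteq> m \<longrightarrow> l2inner A (erestr A l) (erestr A m) = 0) \<and>
     (\<forall>f\<in>L2 A. \<exists>S c. finite S \<and> S \<subseteq> \<Lambda> \<and>
         f = (\<lambda>x. \<Sum>m\<in>S. c m * erestr A m x)))"

definition unitary_on :: "(real^'n) set \<Rightarrow> ((real^'n \<Rightarrow> complex) \<Rightarrow> (real^'n \<Rightarrow> complex)) \<Rightarrow> bool" where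
  "unitary_on A T \<longleftrightarrow>
     (\<forall>f\<in>L2 A. T f \<in> L2 A) \<and>
     (\<forall>f\<in>L2 A. \<forall>g\<in>L2 A. \<forall>c::complex. T (\<lambda>x. f x + c * g x) = (\<lambda>x. T f x + c * T g x)) \<and>
     (\<forall>g\<in>L2 A. \<exists>f\<in>L2 A. T f = g) \<and>
     (\<forall>f\<in>L2 A. \<forall>g\<in>L2 A. l2inner A (T f) (T g) = l2inner A f g)"

end

theory Submission
  imports Defs "HOL-Computational_Algebra.Fundamental_Theorem_Algebra"
begin

text \<open>
  Given a spectrum \<open>\<Lambda>\<close>, let \<open>U(t)\<close> be the diagonal operator \<open>e\<^sub>\<lambda> \<mapsto> e\<^sub>\<lambda>(t) e\<^sub>\<lambda>\<close>; since
  \<open>\<chi>\<^sub>a\<close> has coefficients \<open>e\<^sub>\<lambda>(-a) / N\<close>, the operator \<open>U(a - a')\<close> moves \<open>\<chi>\<^sub>a\<close> to \<open>\<chi>\<close> at \<open>a'\<close>.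

  Conversely, the commuting unitaries \<open>U(t)\<close> on a finite-dimensional space have an orthogonal
  basis of joint eigenvectors. The eigenvalues of a joint eigenvector \<open>v\<close> form a continuous
  character of the additive group, hence are \<open>e\<^sub>\<lambda>(t)\<close> for some \<open>\<lambda>\<close>. Pairing \<open>v\<close> with
  \<open>U(a - a') \<chi>\<^sub>a\<close> gives \<open>v(a') = e\<^sub>\<lambda>(a' - a) v(a)\<close>, so \<open>v\<close> is a multiple of \<open>e\<^sub>\<lambda>\<close> on \<open>A\<close>.
\<close>

subsection \<open>Continuous characters\<close>

text \<open>Additivity alone gives homogeneity over the rationals. The defect
  \<open>h (q *\<^sub>R x) - q * h x\<close> is continuous in \<open>q\<close>, so by density it
  vanishes for every real \<open>q\<close>.\<close>

lemma additive_continuous_imp_linear: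
  fixes h :: "'a::real_normed_vector \<Rightarrow> real"
  assumes cont: "continuous_on UNIV h" and add: "\<And>s t. h (s + t) = h s + h t"
  shows "linear h"
proof (rule linearI[OF add])
  fix r :: real and x :: 'a
  have h0: "h 0 = 0" using add[of 0 0] by simp
  have hminus: "h (- x) = - h x" for x using add[of x "- x"] h0 by simp
  have hnat: "h (real n *\<^sub>R x) = real n * h x" for n :: nat and x
    by (induction n) (simp_all add: h0 add algebra_simps)
  have hint: "h (of_int n *\<^sub>R x) = of_int n * h x" for n :: int and x
  proof (cases n rule: int_cases2)
    case (nonneg m)
    then show ?thesis using hnat[of m x] by simp
  next
    case (nonpos m)
    then show ?thesis using hnat[of m x] hminus[of "real m *\<^sub>R x"] by simp
  qed
  have hrat: "h (q *\<^sub>R x) - q * h x = 0" if q: "q \<in> \<rat>" for q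
  proof -
    obtain a b :: int where "b > 0" and "q = of_int a / of_int b"
      using Rats_cases'[OF q] by metis
    moreover from this have "of_int b * h (q *\<^sub>R x) = of_int a * h x"
      using hint[of b "q *\<^sub>R x"] hint[of a x] by simp
    ultimately have "of_int b * h (q *\<^sub>R x) = of_int b * (q * h x)" by simp
    with \<open>b > 0\<close> show ?thesis by (simp only: mult_cancel_left) simp
  qed
  have "continuous_on (closure \<rat>) (\<lambda>q. h (q *\<^sub>R x) - q * h x)"
    by (intro continuous_intros continuous_on_compose2[OF cont]) auto
  moreover have "r \<in> closure \<rat>" by (simp add: Rats_closure_real)
  ultimately have "h (r *\<^sub>R x) - r * h x = 0"
    using continuous_constant_on_closure[of \<rat> "\<lambda>q. h (q *\<^sub>R x) - q * h x" 0 r] hrat by blast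
  then show "h (r *\<^sub>R x) = r *\<^sub>R h x" by simp
qed

text \<open>The domain is contractible, so the character has a continuous logarithm, which is purely
  imaginary. Normalized to vanish at 0, its imaginary part is additive up to multiples of 2 pi, and
  continuity makes it exactly additive.\<close>

lemma continuous_character_eq_exp:
  fixes \<theta> :: "'a::euclidean_space \<Rightarrow> complex"
  assumes cont: "continuous_on UNIV \<theta>" and mult: "\<And>s t. \<theta> (s + t) = \<theta> s * \<theta> t"
    and unit: "\<And>t. norm (\<theta> t) = 1"
  obtains l where "\<And>t. \<theta> t = exp (\<i> * complex_of_real (l \<bullet> t))"
proof -
  have nz: "\<theta> t \<noteq> 0" for t using unit[of t] norm_zero zero_neq_one by metis
  obtain g where contg: "continuous_on UNIV g" and g: "\<And>t. \<theta> t = exp (g t)"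
    by (rule continuous_logarithm_on_contractible[OF cont contractible_UNIV]) (use nz in auto)
  have Reg: "Re (g t) = 0" for t using unit[of t] by (simp add: g)
  define h where "h t = Im (g t) - Im (g 0)" for t
  have \<theta>0: "\<theta> 0 = 1" using mult[of 0 0] nz[of 0] by simp
  have \<theta>h: "\<theta> t = exp (\<i> * complex_of_real (h t))" for t
  proof -
    have "g t = \<i> * complex_of_real (h t) + g 0"
      by (simp add: h_def complex_eq_iff Reg)
    then show ?thesis using \<theta>0 by (simp add: g exp_add)
  qed
  have conth: "continuous_on UNIV h" unfolding h_def by (intro continuous_intros contg)
  have "h (s + t) = h s + h t" for s t
  proof -
    \<comment> \<open>For fixed \<open>s\<close> this is the additivity defect in units of 2 pi. It
      is continuous with integer values, hence constant, and it vanishes at 0.\<close>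
    define k where "k t = (h (s + t) - h s - h t) / (2 * pi)" for t
    have int: "k t \<in> \<int>" for t
    proof -
      have "exp (\<i> * complex_of_real (h (s + t))) = exp (\<i> * complex_of_real (h s + h t))"
        using mult[of s t] by (simp add: \<theta>h exp_add algebra_simps)
      then obtain n :: int where
        n: "\<i> * complex_of_real (h (s + t)) = \<i> * complex_of_real (h s + h t) + (of_int (2 * n) * pi) * \<i>"
        unfolding exp_eq by blast
      have "h (s + t) = h s + h t + 2 * of_int n * pi"
        using arg_cong[OF n, of Im] by simp
      then show ?thesis by (simp add: k_def)
    qed
    have "k constant_on UNIV"
    proof (rule continuous_discrete_range_constant)
      show "continuous_on UNIV k"
        unfolding k_def by (intro continuous_intros continuous_on_compose2[OF conth]) auto
      fix x
      have "1 \<le> norm (k y - k x)" if "k y \<noteq> k x" for y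
        using Ints_nonzero_abs_ge1[OF Ints_diff[OF int int], of y x] that by simp
      then show "\<exists>e>0. \<forall>y. y \<in> UNIV \<and> k y \<noteq> k x \<longrightarrow> e \<le> norm (k y - k x)"
        by (intro exI[of _ 1]) auto
    qed (rule connected_UNIV)
    then have "k t = k 0" by (auto simp: constant_on_def)
    also have "k 0 = 0" by (simp add: k_def h_def)
    finally show ?thesis by (simp add: k_def)
  qed
  then have "linear h" by (rule additive_continuous_imp_linear[OF conth])
  \<comment> \<open>The adjoint at 1 is the vector representing the linear functional
    \<open>h\<close>.\<close>
  then have "h t = adjoint h 1 \<bullet> t" for t
    using adjoint_works[of h t 1] by (simp add: inner_commute)
  then show thesis using that[of "adjoint h 1"] \<theta>h by simp
qed

subsection \<open>Eigenvectors of operators on functions with finite support\<close>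

text \<open>Gaussian elimination, by induction on the coordinates: a coordinate where all vectors
  vanish is dropped; otherwise a pivot vector \<open>j\<close> clears the coordinate
  \<open>a\<close> from the others and is itself dropped.\<close>

lemma linear_dependence:
  fixes v :: "'i \<Rightarrow> 'a \<Rightarrow> 'k::field"
  assumes "finite A" "finite I" "card A < card I"
  shows "\<exists>c. (\<exists>i\<in>I. c i \<noteq> 0) \<and> (\<forall>a\<in>A. (\<Sum>i\<in>I. c i * v i a) = 0)"
  using assms
proof (induction A arbitrary: I v rule: finite_induct)
  case empty
  then obtain i where "i \<in> I" by fastforce
  then show ?case by (intro exI[of _ "\<lambda>_. 1"]) auto
next
  case (insert a A)
  show ?case
  proof (cases "\<forall>i\<in>I. v i a = 0")
    case True
    have "card A < card I" using insert by simp
    from insert.IH[OF insert.prems(1) this, of v] True show ?thesis by auto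
  next
    case False
    then obtain j where j: "j \<in> I" "v j a \<noteq> 0" by blast
    define w where "w i x = v i x - v i a / v j a * v j x" for i x
    have "card A < card (I - {j})" using insert j by simp
    from insert.IH[OF _ this, of w] insert.prems obtain c
      where c: "\<exists>i\<in>I - {j}. c i \<noteq> 0" "\<And>x. x \<in> A \<Longrightarrow> (\<Sum>i\<in>I - {j}. c i * w i x) = 0"
      by auto
    \<comment> \<open>The pivot's coefficient collects all multiples of \<open>v j\<close>
      subtracted in forming the vectors \<open>w i\<close>, so both combinations agree.\<close>
    define d where "d i = (if i = j then - (\<Sum>i\<in>I - {j}. c i * (v i a / v j a)) else c i)" for i
    have "(\<Sum>i\<in>I. d i * v i x) = (\<Sum>i\<in>I - {j}. c i * w i x)" for x
    proof -
      have "(\<Sum>i\<in>I. d i * v i x) = d j * v j x + (\<Sum>i\<in>I - {j}. d i * v i x)"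
        using insert.prems j by (simp add: sum.remove)
      also have "(\<Sum>i\<in>I - {j}. d i * v i x) = (\<Sum>i\<in>I - {j}. c i * v i x)"
        by (intro sum.cong) (auto simp: d_def)
      also have "d j * v j x = (\<Sum>i\<in>I - {j}. - (c i * (v i a / v j a) * v j x))"
        by (simp add: d_def sum_distrib_right sum_negf)
      finally show ?thesis
        by (simp add: w_def sum.distrib[symmetric] algebra_simps)
    qed
    moreover have "w i a = 0" for i using j by (simp add: w_def)
    moreover have "\<exists>i\<in>I. d i \<noteq> 0" using c(1) by (auto simp: d_def)
    ultimately show ?thesis using c(2) by (intro exI[of _ d]) auto
  qed
qed

text \<open>Functions on \<open>A\<close> are modelled as total functions vanishing off
  \<open>A\<close>, so that two of them are equal as soon as they agree on \<open>A\<close>.\<close>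

definition csubspace :: "'a set \<Rightarrow> ('a \<Rightarrow> complex) set \<Rightarrow> bool" where
  "csubspace A V \<longleftrightarrow> (\<forall>f\<in>V. \<forall>x. x \<notin> A \<longrightarrow> f x = 0) \<and> (\<lambda>x. 0) \<in> V \<and>
     (\<forall>f\<in>V. \<forall>g\<in>V. \<forall>c. (\<lambda>x. f x + c * g x) \<in> V)"

lemma csubspace_supp: "csubspace A V \<Longrightarrow> f \<in> V \<Longrightarrow> x \<notin> A \<Longrightarrow> f x = 0"
  by (simp add: csubspace_def)

lemma csubspace_zero: "csubspace A V \<Longrightarrow> (\<lambda>x. 0) \<in> V"
  by (simp add: csubspace_def)

lemma csubspace_add_scale:
  "csubspace A V \<Longrightarrow> f \<in> V \<Longrightarrow> g \<in> V \<Longrightarrow> (\<lambda>x. f x + c * g x) \<in> V"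
  by (simp add: csubspace_def)

lemma csubspace_scale: "csubspace A V \<Longrightarrow> f \<in> V \<Longrightarrow> (\<lambda>x. c * f x) \<in> V"
  using csubspace_add_scale[of A V "\<lambda>x. 0" f c] csubspace_zero[of A V] by simp

lemma csubspace_sum:
  assumes "csubspace A V" "\<And>i. i \<in> I \<Longrightarrow> w i \<in> V"
  shows "(\<lambda>x. \<Sum>i\<in>I. c i * w i x) \<in> V"
  using assms(2)
proof (induction I rule: infinite_finite_induct)
  case (insert i I)
  then have "(\<lambda>x. (\<Sum>i\<in>I. c i * w i x) + c i * w i x) \<in> V"
    by (intro csubspace_add_scale[OF assms(1)]) auto
  with insert show ?case by (simp add: add.commute)
qed (simp_all add: csubspace_zero[OF assms(1)])

text \<open>Linearity is asked on \<open>V\<close> only, since \<open>unitary_on\<close> says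
  nothing about functions outside \<open>L2 A\<close>.\<close>

definition clinear_on :: "('a \<Rightarrow> complex) set \<Rightarrow> (('a \<Rightarrow> complex) \<Rightarrow> ('a \<Rightarrow> complex)) \<Rightarrow> bool" where
  "clinear_on V T \<longleftrightarrow>
     (\<forall>f\<in>V. \<forall>g\<in>V. \<forall>c. T (\<lambda>x. f x + c * g x) = (\<lambda>x. T f x + c * T g x))"

lemma clinear_onD:
  "clinear_on V T \<Longrightarrow> f \<in> V \<Longrightarrow> g \<in> V \<Longrightarrow>
    T (\<lambda>x. f x + c * g x) = (\<lambda>x. T f x + c * T g x)"
  by (simp add: clinear_on_def)

lemma clinear_on_zero:
  assumes "csubspace A V" "clinear_on V T"
  shows "T (\<lambda>x. 0) = (\<lambda>x. 0)"
  using clinear_onD[OF assms(2) csubspace_zero csubspace_zero, of A A "-1"] assms(1) by simp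

lemma clinear_on_scale:
  assumes "csubspace A V" "clinear_on V T" "f \<in> V"
  shows "T (\<lambda>x. c * f x) = (\<lambda>x. c * T f x)"
  using clinear_onD[OF assms(2) csubspace_zero[OF assms(1)] assms(3), of c]
    clinear_on_zero[OF assms(1,2)] by simp

lemma clinear_on_sum:
  assumes V: "csubspace A V" and T: "clinear_on V T" and w: "\<And>i. i \<in> I \<Longrightarrow> w i \<in> V"
  shows "T (\<lambda>x. \<Sum>i\<in>I. c i * w i x) = (\<lambda>x. \<Sum>i\<in>I. c i * T (w i) x)"
  using w
proof (induction I rule: infinite_finite_induct)
  case (insert i I)
  have "(\<lambda>x. \<Sum>i\<in>I. c i * w i x) \<in> V" using insert by (intro csubspace_sum[OF V]) auto
  then have "T (\<lambda>x. (\<Sum>i\<in>I. c i * w i x) + c i * w i x)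
      = (\<lambda>x. T (\<lambda>x. \<Sum>i\<in>I. c i * w i x) x + c i * T (w i) x)"
    by (rule clinear_onD[OF T]) (simp add: insert.prems)
  with insert show ?case by (simp add: add.commute)
qed (simp_all add: clinear_on_zero[OF V T])

text \<open>A polynomial \<open>p\<close> of least degree with \<open>p(T) v = 0\<close> has a root \<open>z\<close>;
  writing \<open>p = (X - z) q\<close>, the vector \<open>q(T) v\<close> is an eigenvector.\<close>

lemma eigenvector_exists:
  assumes fin: "finite A" and V: "csubspace A V" and T: "clinear_on V T"
    and TV: "\<And>f. f \<in> V \<Longrightarrow> T f \<in> V" and v: "v \<in> V" "v \<noteq> (\<lambda>x. 0)"
  obtains z w where "w \<in> V" "w \<noteq> (\<lambda>x. 0)" "T w = (\<lambda>x. z * w x)"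
proof -
  \<comment> \<open>This is p(T) v.\<close>
  define app where "app p = (\<lambda>x. \<Sum>i\<le>degree p. coeff p i * (T ^^ i) v x)" for p :: "complex poly"
  have app_eq: "app p = (\<lambda>x. \<Sum>i\<le>n. coeff p i * (T ^^ i) v x)" if "degree p \<le> n" for p n
    unfolding app_def using that
    by (intro ext sum.mono_neutral_left) (auto simp: coeff_eq_0)
  have pow: "(T ^^ i) v \<in> V" for i by (induction i) (auto simp: v TV)
  have app_V: "app p \<in> V" for p unfolding app_def by (rule csubspace_sum[OF V pow])
  let ?P = "\<lambda>p. p \<noteq> 0 \<and> app p = (\<lambda>x. 0)"
  have "\<exists>p. ?P p"
  proof -
    \<comment> \<open>The \<open>card A + 1\<close> vectors v, T v, T^2 v, ... have only
      \<open>card A\<close> coordinates, so they are linearly dependent.\<close>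
    obtain c where c: "\<exists>i\<in>{..card A}. c i \<noteq> 0"
        "\<And>a. a \<in> A \<Longrightarrow> (\<Sum>i\<le>card A. c i * (T ^^ i) v a) = 0"
      using linear_dependence[OF fin, of "{..card A}" "\<lambda>i. (T ^^ i) v"] by auto
    define p where "p = (\<Sum>i\<le>card A. monom (c i) i)"
    have coeff: "coeff p i = (if i \<le> card A then c i else 0)" for i
      by (simp add: p_def coeff_sum)
    have "p \<noteq> 0" using c(1) coeff by (metis atMost_iff coeff_0)
    moreover have "degree p \<le> card A" by (rule degree_le) (simp add: coeff)
    then have "app p = (\<lambda>x. \<Sum>i\<le>card A. c i * (T ^^ i) v x)"
      by (simp add: app_eq coeff)
    moreover have "(\<Sum>i\<le>card A. c i * (T ^^ i) v x) = 0" for x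
    proof (cases "x \<in> A")
      case False
      then have "(T ^^ i) v x = 0" for i using csubspace_supp[OF V pow] by blast
      then show ?thesis by simp
    qed (use c in auto)
    ultimately show ?thesis by auto
  qed
  then obtain p where p: "?P p" and least: "\<And>q. ?P q \<Longrightarrow> degree p \<le> degree q"
    using ex_has_least_nat[of ?P _ degree] by blast
  have "degree p \<noteq> 0"
  proof
    assume "degree p = 0"
    then obtain c where "p = [:c:]" using degree_eq_zeroE by blast
    with p have "c \<noteq> 0" "\<And>x. c * v x = 0" by (auto simp: app_def fun_eq_iff)
    with v show False by auto
  qed
  then obtain z where "poly p z = 0"
    using fundamental_theorem_of_algebra[of p] by (auto simp: constant_degree)
  then obtain q where q: "p = [:-z, 1:] * q" by (metis dvdE poly_eq_0_iff_dvd)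
  with p have q0: "q \<noteq> 0" by auto
  have deg: "degree p = Suc (degree q)" unfolding q using q0 by (subst degree_mult_eq) auto
  have "app q \<noteq> (\<lambda>x. 0)" using least[of q] q0 deg by auto
  moreover have "T (app q) = (\<lambda>x. z * app q x)"
  proof -
    have Tq: "T (app q) = (\<lambda>x. \<Sum>i\<le>degree q. coeff q i * (T ^^ Suc i) v x)"
      unfolding app_def using clinear_on_sum[OF V T pow] by simp
    have co: "coeff p i = coeff (pCons 0 q) i - z * coeff q i" for i
      by (simp add: q)
    have "app p x = T (app q) x - z * app q x" for x
    proof -
      \<comment> \<open>Since p = X q - z q, the sum splits in two. Both run to
        \<open>Suc (degree q)\<close>, where the coefficient of \<open>q\<close> is zero; the shift
        in \<open>pCons 0 q\<close> becomes one more application of \<open>T\<close>.\<close>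
      have "app p x = (\<Sum>i\<le>Suc (degree q). coeff (pCons 0 q) i * (T ^^ i) v x)
          - z * (\<Sum>i\<le>Suc (degree q). coeff q i * (T ^^ i) v x)"
        unfolding app_def deg co
        by (simp only: left_diff_distrib sum_subtractf sum_distrib_left mult.assoc)
      also have "(\<Sum>i\<le>Suc (degree q). coeff q i * (T ^^ i) v x) = app q x"
        by (simp add: app_eq[of q "Suc (degree q)"])
      also have "(\<Sum>i\<le>Suc (degree q). coeff (pCons 0 q) i * (T ^^ i) v x) = T (app q) x"
        by (subst sum.atMost_Suc_shift) (simp add: Tq)
      finally show ?thesis .
    qed
    then show ?thesis using p by (simp add: fun_eq_iff)
  qed
  ultimately show thesis using that app_V by blast
qed

subsection \<open>Orthogonal families in \<open>L\<^sup>2(A)\<close>\<close>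

lemma csubspace_L2: "csubspace A (L2 A)"
  by (simp add: csubspace_def L2_def)

lemma l2inner_add_scale_left:
  "l2inner A (\<lambda>x. f x + c * g x) h = l2inner A f h + c * l2inner A g h"
  by (simp add: l2inner_def algebra_simps sum.distrib sum_distrib_left)

lemma l2inner_sum_left:
  "l2inner A (\<lambda>x. \<Sum>i\<in>I. c i * w i x) h = (\<Sum>i\<in>I. c i * l2inner A (w i) h)"
proof -
  have "(\<Sum>a\<in>A. (\<Sum>i\<in>I. c i * w i a) * cnj (h a)) = (\<Sum>i\<in>I. c i * (\<Sum>a\<in>A. w i a * cnj (h a)))"
    unfolding sum_distrib_left sum_distrib_right by (subst sum.swap) (simp add: mult.assoc)
  then show ?thesis by (simp add: l2inner_def sum_distrib_left mult.left_commute)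
qed

lemma l2inner_scale_left: "l2inner A (\<lambda>x. c * f x) g = c * l2inner A f g"
  by (simp add: l2inner_def sum_distrib_left mult.assoc mult.left_commute)

lemma l2inner_commute: "l2inner A g f = cnj (l2inner A f g)"
  by (simp add: l2inner_def mult.commute)

lemma l2inner_scale_right: "l2inner A f (\<lambda>x. c * g x) = cnj c * l2inner A f g"
  by (simp add: l2inner_commute[of A f] l2inner_scale_left)

lemma l2inner_sum_right:
  "l2inner A h (\<lambda>x. \<Sum>i\<in>I. c i * w i x) = (\<Sum>i\<in>I. cnj (c i) * l2inner A h (w i))"
  by (simp add: l2inner_commute[of A h] l2inner_sum_left)

lemma l2inner_zero_left: "l2inner A (\<lambda>x. 0) g = 0"
  by (simp add: l2inner_def)

lemma l2inner_self_eq_0: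
  assumes "finite A" "f \<in> L2 A" "l2inner A f f = 0"
  shows "f = (\<lambda>x. 0)"
proof
  fix x
  show "f x = 0"
  proof (cases "x \<in> A")
    case True
    then have "(\<Sum>a\<in>A. f a * cnj (f a)) = 0"
      using assms by (auto simp: l2inner_def)
    then have "complex_of_real (\<Sum>a\<in>A. (cmod (f a))\<^sup>2) = 0"
      by (simp only: of_real_sum complex_norm_square)
    then have "(\<Sum>a\<in>A. (cmod (f a))\<^sup>2) = 0" by (simp only: of_real_eq_0_iff)
    with True assms(1) have "(cmod (f x))\<^sup>2 = 0" by (subst (asm) sum_nonneg_eq_0_iff) auto
    then show ?thesis by simp
  qed (use assms in \<open>simp add: L2_def\<close>)
qed

lemma l2inner_chi_left:
  assumes "finite A" "a \<in> A"
  shows "l2inner A (chi a) f = cnj (f a) / of_nat (card A)"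
proof -
  have "(\<Sum>x\<in>A. chi a x * cnj (f x)) = (\<Sum>x\<in>A. if x = a then cnj (f x) else 0)"
    by (intro sum.cong) (auto simp: chi_def)
  then show ?thesis using assms by (simp add: l2inner_def)
qed

lemma chi_in_L2: "a \<in> A \<Longrightarrow> chi a \<in> L2 A"
  by (auto simp: chi_def L2_def)

text \<open>Indexing lets the notion cover exponentials indexed by frequency as well as sets of
  functions indexed by themselves. Excluding zero vectors makes such families linearly
  independent.\<close>

definition orthfam :: "(real^'n) set \<Rightarrow> 'i set \<Rightarrow> ('i \<Rightarrow> real^'n \<Rightarrow> complex) \<Rightarrow> bool" where
  "orthfam A I w \<longleftrightarrow> (\<forall>i\<in>I. w i \<in> L2 A \<and> w i \<noteq> (\<lambda>x. 0)) \<and>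
     (\<forall>i\<in>I. \<forall>j\<in>I. i \<noteq> j \<longrightarrow> l2inner A (w i) (w j) = 0)"

lemma orthfam_l2inner_sum:
  assumes "orthfam A I w" "finite I" "j \<in> I"
  shows "l2inner A (\<lambda>x. \<Sum>i\<in>I. c i * w i x) (w j) = c j * l2inner A (w j) (w j)"
proof -
  have "l2inner A (\<lambda>x. \<Sum>i\<in>I. c i * w i x) (w j) = (\<Sum>i\<in>I. c i * l2inner A (w i) (w j))"
    by (rule l2inner_sum_left)
  also have "\<dots> = (\<Sum>i\<in>I. if i = j then c j * l2inner A (w j) (w j) else 0)"
    using assms by (intro sum.cong) (auto simp: orthfam_def)
  finally show ?thesis using assms by simp
qed

lemma orthfam_norm_nonzero:
  assumes "finite A" "orthfam A I w" "i \<in> I"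
  shows "l2inner A (w i) (w i) \<noteq> 0"
  using assms l2inner_self_eq_0[of A "w i"] by (auto simp: orthfam_def)

text \<open>A larger family would satisfy a nontrivial linear relation; pairing it with a member
  \<open>w j\<close> isolates the coefficient \<open>c j\<close>, which must then vanish.\<close>

lemma orthfam_card_le:
  assumes fin: "finite A" and w: "orthfam A I w" "finite I"
  shows "card I \<le> card A"
proof (rule ccontr)
  assume "\<not> card I \<le> card A"
  then obtain c where c: "\<exists>i\<in>I. c i \<noteq> 0" "\<forall>a\<in>A. (\<Sum>i\<in>I. c i * w i a) = 0"
    using linear_dependence[OF fin w(2), of w] by auto
  then obtain j where j: "j \<in> I" "c j \<noteq> 0" by blast
  have "l2inner A (\<lambda>x. \<Sum>i\<in>I. c i * w i x) (w j) = 0"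
    using c(2) by (simp add: l2inner_def)
  with j orthfam_l2inner_sum[OF w j(1), of c] orthfam_norm_nonzero[OF fin w(1) j(1)]
  show False by simp
qed

text \<open>A Gram-Schmidt step: the orthogonal projection onto the span of the family is subtracted
  from \<open>f\<close>.\<close>

lemma orthfam_residual:
  assumes fin: "finite A" and w: "orthfam A I w" "finite I"
  obtains c where "\<And>j. j \<in> I \<Longrightarrow> l2inner A (\<lambda>x. f x + (-1) * (\<Sum>i\<in>I. c i * w i x)) (w j) = 0"
proof
  define c where "c i = l2inner A f (w i) / l2inner A (w i) (w i)" for i
  fix j assume "j \<in> I"
  then show "l2inner A (\<lambda>x. f x + (-1) * (\<Sum>i\<in>I. c i * w i x)) (w j) = 0"
    using orthfam_norm_nonzero[OF fin w(1)]
    by (simp only: l2inner_add_scale_left orthfam_l2inner_sum[OF w]) (simp add: c_def)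
qed

text \<open>For finite \<open>A\<close> and a subspace \<open>V\<close> this is the dimension of
  \<open>V\<close>, counted by orthogonal families. It serves as the measure by which a smallest
  invariant subspace is chosen.\<close>

definition orthdim :: "(real^'n) set \<Rightarrow> (real^'n \<Rightarrow> complex) set \<Rightarrow> nat" where
  "orthdim A V = Max {card S |S. S \<subseteq> V \<and> finite S \<and> orthfam A S (\<lambda>f. f)}"

text \<open>A largest orthogonal family in \<open>V'\<close> is extended by the residual of some
  \<open>g\<close> in \<open>V\<close> outside \<open>V'\<close>. The residual is nonzero because
  the projection of \<open>g\<close> lies in \<open>V'\<close>.\<close>

lemma orthdim_less:
  assumes fin: "finite A" and V: "csubspace A V" and V': "csubspace A V'" and sub: "V' \<subset> V"
  shows "orthdim A V' < orthdim A V"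
proof -
  let ?K = "\<lambda>V. {card S |S. S \<subseteq> V \<and> finite S \<and> orthfam A S (\<lambda>f. f)}"
  have finK: "finite (?K V)" for V
    by (rule finite_subset[of _ "{..card A}"]) (auto intro: orthfam_card_le[OF fin])
  \<comment> \<open>The empty family counts, so the maximum is over a nonempty set and is
    attained.\<close>
  have "card {} \<in> ?K V'" by (intro CollectI exI[of _ "{}"]) (auto simp: orthfam_def)
  then have "Max (?K V') \<in> ?K V'" by (intro Max_in finK) auto
  then obtain S where S: "S \<subseteq> V'" "finite S" "orthfam A S (\<lambda>f. f)" "orthdim A V' = card S"
    unfolding orthdim_def by auto
  obtain g where g: "g \<in> V" "g \<notin> V'" using sub by blast
  obtain c where c: "\<And>s. s \<in> S \<Longrightarrow> l2inner A (\<lambda>x. g x + (-1) * (\<Sum>i\<in>S. c i * i x)) s = 0"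
    using orthfam_residual[OF fin S(3,2), of g] by blast
  define p where "p = (\<lambda>x. \<Sum>i\<in>S. c i * i x)"
  define r where "r = (\<lambda>x. g x + (-1) * p x)"
  have p: "p \<in> V'" unfolding p_def using S(1) by (intro csubspace_sum[OF V']) auto
  have rV: "r \<in> V" unfolding r_def using g p sub by (intro csubspace_add_scale[OF V]) auto
  then have rL2: "r \<in> L2 A" using csubspace_supp[OF V rV] by (auto simp: L2_def)
  have "r \<noteq> (\<lambda>x. 0)"
  proof
    assume "r = (\<lambda>x. 0)"
    then have "g = p" by (auto simp: r_def fun_eq_iff)
    with p g show False by simp
  qed
  have orth: "l2inner A r s = 0" "l2inner A s r = 0" if "s \<in> S" for s
    using c[OF that] l2inner_commute[of A s r] by (simp_all add: r_def p_def)
  have "r \<notin> S" using orth(1)[of r] l2inner_self_eq_0[OF fin rL2] \<open>r \<noteq> (\<lambda>x. 0)\<close> by blast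
  moreover have "orthfam A (insert r S) (\<lambda>f. f)"
    using S(3) orth rL2 \<open>r \<noteq> (\<lambda>x. 0)\<close> unfolding orthfam_def by auto
  then have "card (insert r S) \<in> ?K V" using rV S sub by (intro CollectI exI[of _ "insert r S"]) auto
  then have "card (insert r S) \<le> orthdim A V" unfolding orthdim_def by (rule Max_ge[OF finK])
  ultimately show ?thesis using S by simp
qed

text \<open>In an invariant subspace of least dimension, an eigenspace of one operator is invariant
  under all the others, hence is the whole subspace: every operator acts as a scalar.\<close>

lemma joint_eigenvector_exists:
  fixes U :: "'t \<Rightarrow> (real^'n \<Rightarrow> complex) \<Rightarrow> real^'n \<Rightarrow> complex"
  assumes fin: "finite A" and V: "csubspace A V" "f \<in> V" "f \<noteq> (\<lambda>x. 0)"
    and lin: "\<And>t. clinear_on V (U t)" and inv: "\<And>t g. g \<in> V \<Longrightarrow> U t g \<in> V"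
    and comm: "\<And>s t g. g \<in> V \<Longrightarrow> U s (U t g) = U t (U s g)"
  obtains v \<theta> where "v \<in> V" "v \<noteq> (\<lambda>x. 0)" "\<And>t. U t v = (\<lambda>x. \<theta> t * v x)"
proof -
  \<comment> \<open>Demanding a nonzero element keeps the zero subspace from being the
    minimum.\<close>
  let ?P = "\<lambda>W. csubspace A W \<and> W \<subseteq> V \<and> (\<exists>w\<in>W. w \<noteq> (\<lambda>x. 0)) \<and> (\<forall>t. \<forall>g\<in>W. U t g \<in> W)"
  have "?P V" using V inv by auto
  then obtain W where W: "?P W" and least: "\<And>W'. ?P W' \<Longrightarrow> orthdim A W \<le> orthdim A W'"
    using ex_has_least_nat[of ?P V "orthdim A"] by blast
  then obtain w where w: "w \<in> W" "w \<noteq> (\<lambda>x. 0)" by blast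
  have WV: "g \<in> V" if "g \<in> W" for g using that W by blast
  have linW: "clinear_on W (U t)" for t using lin[of t] W unfolding clinear_on_def by blast
  have subW: "csubspace A W" using W by simp
  have "\<exists>z. \<forall>g\<in>W. U t g = (\<lambda>x. z * g x)" for t
  proof -
    obtain z e where e: "e \<in> W" "e \<noteq> (\<lambda>x. 0)" "U t e = (\<lambda>x. z * e x)"
      using eigenvector_exists[OF fin subW linW _ w, of t] W by metis
    define W' where "W' = {g\<in>W. U t g = (\<lambda>x. z * g x)}"
    have subW': "csubspace A W'"
      unfolding csubspace_def
    proof (intro conjI ballI allI impI)
      show "g x = 0" if "g \<in> W'" "x \<notin> A" for g x
        using that csubspace_supp[OF subW] by (simp add: W'_def)
      show "(\<lambda>x. 0) \<in> W'"
        using csubspace_zero[OF subW] clinear_on_zero[OF subW linW] by (simp add: W'_def)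
      show "(\<lambda>x. g x + c * h x) \<in> W'" if "g \<in> W'" "h \<in> W'" for g h c
        using that csubspace_add_scale[OF subW, of g h c] clinear_onD[OF linW, of g h t c]
        by (simp add: W'_def algebra_simps)
    qed
    have "U s g \<in> W'" if "g \<in> W'" for s g
    proof -
      have g: "g \<in> W" "U t g = (\<lambda>x. z * g x)" using that by (auto simp: W'_def)
      then have "U t (U s g) = U s (\<lambda>x. z * g x)" using comm[OF WV, of g t s] by simp
      also have "\<dots> = (\<lambda>x. z * U s g x)" by (rule clinear_on_scale[OF subW linW g(1)])
      finally show ?thesis using W g by (simp add: W'_def)
    qed
    moreover have "e \<in> W'" "W' \<subseteq> W" using e by (auto simp: W'_def)
    ultimately have "?P W'" using subW' W e(2) by blast
    then have "\<not> orthdim A W' < orthdim A W" using least by (simp add: not_less)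
    then have "W' = W" using orthdim_less[OF fin subW subW'] \<open>W' \<subseteq> W\<close> by blast
    then show ?thesis by (auto simp: W'_def)
  qed
  then obtain \<theta> where "\<And>t g. g \<in> W \<Longrightarrow> U t g = (\<lambda>x. \<theta> t * g x)" by metis
  then show thesis using that[of w \<theta>] w WV by blast
qed

subsection \<open>Exponentials\<close>

lemma echar_add: "echar l (x + y) = echar l x * echar l y"
  by (simp add: echar_def inner_add_right algebra_simps exp_add)

lemma echar_nonzero: "echar l x \<noteq> 0"
  by (simp add: echar_def)

lemma echar_zero: "echar l 0 = 1"
  by (simp add: echar_def)

lemma cnj_echar: "cnj (echar l x) = echar l (- x)"
  by (simp add: echar_def exp_cnj)

lemma echar_minus_cancel: "echar l (- x) * echar l x = 1"
  using echar_add[of l "- x" x] by (simp add: echar_zero)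

lemma continuous_on_echar: "continuous_on S (echar l)"
  unfolding echar_def by (intro continuous_intros)

lemma echar_separates:
  assumes "l \<noteq> m"
  obtains t where "echar l t * cnj (echar m t) \<noteq> 1"
proof
  \<comment> \<open>Scaled so that \<open>(l - m) \<bullet> t\<close> is 1/2, which makes the
    quotient of the two characters at \<open>t\<close> equal to -1.\<close>
  define t where "t = (1 / (2 * ((l - m) \<bullet> (l - m)))) *\<^sub>R (l - m)"
  have "(l - m) \<bullet> t = 1 / 2" using assms by (simp add: t_def)
  then have e: "l \<bullet> t - m \<bullet> t = 1 / 2" by (simp only: inner_diff_left)
  have "echar l t * cnj (echar m t)
      = exp (2 * complex_of_real pi * \<i> * complex_of_real (l \<bullet> t - m \<bullet> t))"
    unfolding cnj_echar by (simp add: echar_def exp_add[symmetric] algebra_simps)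
  also have "\<dots> = exp (complex_of_real pi * \<i>)" unfolding e by simp
  finally show "echar l t * cnj (echar m t) \<noteq> 1" by (simp add: exp_pi_i)
qed

lemma erestr_in_L2: "erestr A l \<in> L2 A"
  by (simp add: erestr_def L2_def)

lemma l2inner_erestr_self:
  assumes "finite A" "A \<noteq> {}"
  shows "l2inner A (erestr A l) (erestr A l) = 1"
proof -
  have "(\<Sum>a\<in>A. erestr A l a * cnj (erestr A l a)) = (\<Sum>a\<in>A. 1)"
    by (intro sum.cong)
      (simp_all add: erestr_def cnj_echar echar_minus_cancel mult.commute[of "echar l _"])
  then show ?thesis using assms by (simp add: l2inner_def)
qed

lemma orthfam_erestr:
  assumes "finite A" "A \<noteq> {}"
    and "\<forall>l\<in>L. \<forall>m\<in>L. l \<noteq> m \<longrightarrow> l2inner A (erestr A l) (erestr A m) = 0"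
  shows "orthfam A L (erestr A)"
proof -
  have "erestr A l \<noteq> (\<lambda>x. 0)" for l
    using l2inner_erestr_self[OF assms(1,2), of l] l2inner_zero_left[of A "erestr A l"] by auto
  then show ?thesis using assms(3) by (simp add: orthfam_def erestr_in_L2)
qed

subsection \<open>From a spectrum to a unitary group\<close>

text \<open>In \<open>spectral\<close> each function may use its own finite set of frequencies.
  Uniting the sets used by the finitely many \<open>chi a\<close>, which span \<open>L2 A\<close>,
  gives one set that serves all functions.\<close>

lemma spectral_imp_finite_spectrum:
  assumes "finite A" "spectral A"
  obtains S where "finite S"
    "\<forall>l\<in>S. \<forall>m\<in>S. l \<noteq> m \<longrightarrow> l2inner A (erestr A l) (erestr A m) = 0"
    "\<And>f. f \<in> L2 A \<Longrightarrow> \<exists>c. f = (\<lambda>x. \<Sum>m\<in>S. c m * erestr A m x)"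
proof -
  obtain L where
    orth: "\<forall>l\<in>L. \<forall>m\<in>L. l \<noteq> m \<longrightarrow> l2inner A (erestr A l) (erestr A m) = 0" and
    span: "\<And>f. f \<in> L2 A \<Longrightarrow> \<exists>S c. finite S \<and> S \<subseteq> L \<and> f = (\<lambda>x. \<Sum>m\<in>S. c m * erestr A m x)"
    using assms(2) unfolding spectral_def by blast
  have "\<forall>a\<in>A. \<exists>S c. finite S \<and> S \<subseteq> L \<and> chi a = (\<lambda>x. \<Sum>m\<in>S. c m * erestr A m x)"
    using span chi_in_L2 by blast
  then obtain S c where S: "\<And>a. a \<in> A \<Longrightarrow> finite (S a) \<and> S a \<subseteq> L \<and>
      chi a = (\<lambda>x. \<Sum>m\<in>S a. c a m * erestr A m x)"
    by metis
  define T where "T = (\<Union>a\<in>A. S a)"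
  have finT: "finite T" using S assms(1) by (auto simp: T_def)
  have "\<exists>c. f = (\<lambda>x. \<Sum>m\<in>T. c m * erestr A m x)" if "f \<in> L2 A" for f
  proof -
    define d where "d a m = (if m \<in> S a then c a m else 0)" for a m
    have chi: "chi a x = (\<Sum>m\<in>T. d a m * erestr A m x)" if "a \<in> A" for a x
    proof -
      have "chi a x = (\<Sum>m\<in>S a. c a m * erestr A m x)" using S[OF that] by metis
      also have "\<dots> = (\<Sum>m\<in>T. d a m * erestr A m x)"
        using finT that by (intro sum.mono_neutral_cong_left) (auto simp: T_def d_def)
      finally show ?thesis .
    qed
    have "f x = (\<Sum>m\<in>T. (\<Sum>a\<in>A. f a * d a m) * erestr A m x)" for x
    proof -
      have "f x = (\<Sum>a\<in>A. if a = x then f a else 0)"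
        using assms(1) \<open>f \<in> L2 A\<close> by (auto simp: L2_def)
      also have "\<dots> = (\<Sum>a\<in>A. f a * chi a x)" by (intro sum.cong) (auto simp: chi_def)
      also have "\<dots> = (\<Sum>a\<in>A. \<Sum>m\<in>T. f a * d a m * erestr A m x)"
        by (intro sum.cong) (simp_all add: chi sum_distrib_left mult.assoc)
      finally show ?thesis by (subst (asm) sum.swap) (simp add: sum_distrib_right)
    qed
    then show ?thesis by (intro exI[of _ "\<lambda>m. \<Sum>a\<in>A. f a * d a m"] ext)
  qed
  moreover have "T \<subseteq> L" using S by (auto simp: T_def)
  ultimately show thesis using that[of T] finT orth by blast
qed

text \<open>The diagonal operator of the overview. Coefficients are plain inner products because,
  for nonempty \<open>A\<close>, the exponentials have norm 1 in the normalized inner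
  product.\<close>

definition modulate ::
    "(real^'n) set \<Rightarrow> (real^'n) set \<Rightarrow> real^'n \<Rightarrow> (real^'n \<Rightarrow> complex) \<Rightarrow> real^'n \<Rightarrow> complex" where
  "modulate A S t f = (\<lambda>x. \<Sum>m\<in>S. (l2inner A f (erestr A m) * echar m t) * erestr A m x)"

locale finite_spectrum =
  fixes A :: "(real^'n) set" and S
  assumes fin: "finite A" and ne: "A \<noteq> {}" and finS: "finite S"
    and orth: "\<forall>l\<in>S. \<forall>m\<in>S. l \<noteq> m \<longrightarrow> l2inner A (erestr A l) (erestr A m) = 0"
    and span: "\<And>f. f \<in> L2 A \<Longrightarrow> \<exists>c. f = (\<lambda>x. \<Sum>m\<in>S. c m * erestr A m x)"
begin

lemma l2inner_expansion:
  "m \<in> S \<Longrightarrow> l2inner A (\<lambda>x. \<Sum>m\<in>S. c m * erestr A m x) (erestr A m) = c m"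
  using orthfam_l2inner_sum[OF orthfam_erestr[OF fin ne orth] finS]
    l2inner_erestr_self[OF fin ne] by simp

lemma parseval:
  "l2inner A (\<lambda>x. \<Sum>m\<in>S. c m * erestr A m x) (\<lambda>x. \<Sum>m\<in>S. d m * erestr A m x)
    = (\<Sum>m\<in>S. c m * cnj (d m))"
  by (simp add: l2inner_sum_right l2inner_expansion mult.commute)

text \<open>Orthonormality forces the coefficients of any expansion to be the inner products with
  the exponentials.\<close>

lemma expansion:
  assumes "f \<in> L2 A"
  shows "f = (\<lambda>x. \<Sum>m\<in>S. l2inner A f (erestr A m) * erestr A m x)"
proof -
  obtain c where c: "f = (\<lambda>x. \<Sum>m\<in>S. c m * erestr A m x)" using span[OF assms] by blast
  have "l2inner A f (erestr A m) = c m" if "m \<in> S" for m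
    unfolding c by (rule l2inner_expansion[OF that])
  then have "(\<lambda>x. \<Sum>m\<in>S. l2inner A f (erestr A m) * erestr A m x) = (\<lambda>x. \<Sum>m\<in>S. c m * erestr A m x)"
    by simp
  with c show ?thesis by simp
qed

lemma modulate_in_L2: "modulate A S t f \<in> L2 A"
  unfolding modulate_def by (rule csubspace_sum[OF csubspace_L2 erestr_in_L2])

lemma modulate_add: "modulate A S (t + s) f = modulate A S t (modulate A S s f)"
proof -
  have "l2inner A (modulate A S s f) (erestr A m) = l2inner A f (erestr A m) * echar m s"
    if "m \<in> S" for m
    unfolding modulate_def by (rule l2inner_expansion[OF that])
  then show ?thesis
    unfolding modulate_def[of A S "t + s"] modulate_def[of A S t]
    by (intro ext sum.cong) (simp_all add: echar_add)
qed

lemma modulate_zero: "f \<in> L2 A \<Longrightarrow> modulate A S 0 f = f"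
  using expansion[of f] by (simp add: modulate_def echar_zero)

lemma unitary_on_modulate: "unitary_on A (modulate A S t)"
  unfolding unitary_on_def
proof (intro conjI ballI allI)
  show "modulate A S t f \<in> L2 A" for f by (rule modulate_in_L2)
  show "modulate A S t (\<lambda>x. f x + c * g x) = (\<lambda>x. modulate A S t f x + c * modulate A S t g x)" for f g c
    by (simp add: modulate_def l2inner_add_scale_left algebra_simps sum.distrib sum_distrib_left)
  show "\<exists>f\<in>L2 A. modulate A S t f = g" if "g \<in> L2 A" for g
    using modulate_in_L2 modulate_add[of t "- t" g] modulate_zero[OF that]
    by (intro bexI[of _ "modulate A S (- t) g"]) simp_all
  fix f g assume "f \<in> L2 A" "g \<in> L2 A"
  \<comment> \<open>By Parseval each term only gains the factor
    \<open>echar m (- t) * echar m t\<close>, which is 1.\<close>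
  have "l2inner A (modulate A S t f) (modulate A S t g)
      = (\<Sum>m\<in>S. l2inner A f (erestr A m) * cnj (l2inner A g (erestr A m)) * (echar m (- t) * echar m t))"
    unfolding modulate_def parseval by (intro sum.cong) (simp_all add: cnj_echar ac_simps)
  also have "\<dots> = (\<Sum>m\<in>S. l2inner A f (erestr A m) * cnj (l2inner A g (erestr A m)))"
    by (simp add: echar_minus_cancel)
  also have "\<dots> = l2inner A f g"
    by (simp only: parseval[symmetric] expansion[OF \<open>f \<in> L2 A\<close>, symmetric]
        expansion[OF \<open>g \<in> L2 A\<close>, symmetric])
  finally show "l2inner A (modulate A S t f) (modulate A S t g) = l2inner A f g" .
qed

lemma modulate_chi:
  assumes "a \<in> A" "a' \<in> A"
  shows "modulate A S (a - a') (chi a) = chi a'"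
proof -
  have "l2inner A (chi a) (erestr A m) * echar m (a - a') = l2inner A (chi a') (erestr A m)" for m
    using assms echar_add[of m "- a" "a - a'"]
    by (simp add: l2inner_chi_left fin erestr_def cnj_echar)
  then show ?thesis using expansion[OF chi_in_L2[OF assms(2)]] by (simp add: modulate_def)
qed

lemma continuous_on_modulate: "continuous_on UNIV (\<lambda>t. modulate A S t f x)"
  unfolding modulate_def by (intro continuous_intros continuous_on_echar)

end

subsection \<open>From a unitary group to a spectrum\<close>

locale unitary_group =
  fixes A :: "(real^'n) set"
    and U :: "real^'n \<Rightarrow> ((real^'n \<Rightarrow> complex) \<Rightarrow> (real^'n \<Rightarrow> complex))"
  assumes fin: "finite A" and ne: "A \<noteq> {}"
    and unitary: "\<And>t. unitary_on A (U t)"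
    and cont: "\<And>f x. f \<in> L2 A \<Longrightarrow> continuous_on UNIV (\<lambda>t. U t f x)"
    and group: "\<And>t s f. f \<in> L2 A \<Longrightarrow> U (t + s) f = U t (U s f)"
    and shift: "\<And>a a'. a \<in> A \<Longrightarrow> a' \<in> A \<Longrightarrow> U (a - a') (chi a) = chi a'"
begin

lemma U_in_L2: "f \<in> L2 A \<Longrightarrow> U t f \<in> L2 A"
  using unitary[of t] by (simp add: unitary_on_def)

lemma U_linear: "clinear_on (L2 A) (U t)"
  using unitary[of t] by (simp add: unitary_on_def clinear_on_def)

lemma U_scale: "f \<in> L2 A \<Longrightarrow> U t (\<lambda>x. c * f x) = (\<lambda>x. c * U t f x)"
  by (rule clinear_on_scale[OF csubspace_L2 U_linear])

lemma l2inner_U: "f \<in> L2 A \<Longrightarrow> g \<in> L2 A \<Longrightarrow> l2inner A (U t f) (U t g) = l2inner A f g"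
  using unitary[of t] by (simp add: unitary_on_def)

lemma joint_eigenvector_eq_exponential:
  assumes v: "v \<in> L2 A" "v \<noteq> (\<lambda>x. 0)" and eig: "\<And>t. U t v = (\<lambda>x. \<theta> t * v x)"
  obtains l C where "C \<noteq> 0" "v = (\<lambda>x. C * erestr A l x)" "\<And>t. \<theta> t = echar l t"
proof -
  obtain b where b: "v b \<noteq> 0" using v(2) by auto
  with v(1) have bA: "b \<in> A" by (auto simp: L2_def)
  \<comment> \<open>Reading the eigenvalue off at a point where \<open>v\<close> is nonzero
    transfers the continuity of \<open>U\<close> to \<open>\<theta>\<close>.\<close>
  have \<theta>_eq: "\<theta> t = U t v b / v b" for t using b by (simp add: eig)
  have "l2inner A v v \<noteq> 0" using l2inner_self_eq_0[OF fin v(1)] v(2) by blast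
  moreover have "\<theta> t * cnj (\<theta> t) * l2inner A v v = l2inner A v v" for t
    using l2inner_U[OF v(1) v(1), of t]
    by (simp add: eig l2inner_scale_left l2inner_scale_right mult.assoc mult.left_commute)
  ultimately have \<theta>_cnj: "\<theta> t * cnj (\<theta> t) = 1" for t by simp
  have "norm (\<theta> t) = 1" for t
    using arg_cong[OF \<theta>_cnj[of t], of cmod] norm_ge_zero[of "\<theta> t"]
    by (simp add: norm_mult power2_eq_square[symmetric] power2_eq_1_iff)
  moreover have "\<theta> (s + t) = \<theta> s * \<theta> t" for s t
  proof -
    have "U (s + t) v = (\<lambda>x. \<theta> t * (\<theta> s * v x))"
      using group[OF v(1), of s t] U_scale[OF v(1), of s "\<theta> t"] by (simp add: eig)
    then show ?thesis using b by (simp add: \<theta>_eq[of "s + t"])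
  qed
  moreover have "continuous_on UNIV \<theta>"
    unfolding \<theta>_eq[abs_def] using b by (intro continuous_intros cont v) auto
  ultimately obtain k where k: "\<And>t. \<theta> t = exp (\<i> * complex_of_real (k \<bullet> t))"
    using continuous_character_eq_exp[of \<theta>] by blast
  define l where "l = (1 / (2 * pi)) *\<^sub>R k"
  have \<theta>: "\<theta> t = echar l t" for t by (simp add: k l_def echar_def)
  have "v x = echar l (x - b) * v b" if "x \<in> A" for x
  proof -
    \<comment> \<open>\<open>U (b - x)\<close> takes \<open>chi b\<close> to \<open>chi x\<close>
      and multiplies \<open>v\<close> by \<open>echar l (b - x)\<close>; the factor
      \<open>echar l (x - b)\<close> compensates for the latter.\<close>
    have "l2inner A (chi x) v = l2inner A (U (b - x) (chi b)) (U (b - x) (\<lambda>y. echar l (x - b) * v y))"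
      using shift[OF bA that] v(1) echar_minus_cancel[of l "b - x"]
      by (simp add: U_scale eig \<theta> mult.assoc[symmetric])
    also have "\<dots> = l2inner A (chi b) (\<lambda>y. echar l (x - b) * v y)"
      by (rule l2inner_U[OF chi_in_L2[OF bA] csubspace_scale[OF csubspace_L2 v(1)]])
    finally have "cnj (v x) = cnj (echar l (x - b) * v b)"
      using fin ne by (simp add: l2inner_chi_left bA that)
    then show ?thesis by (simp only: complex_cnj_cancel_iff)
  qed
  moreover have "echar l (x - b) = echar l (- b) * echar l x" for x
    using echar_add[of l "- b" x] by simp
  ultimately have "v = (\<lambda>x. (echar l (- b) * v b) * erestr A l x)"
    using v(1) by (auto simp: fun_eq_iff erestr_def L2_def)
  then show thesis using that[of "echar l (- b) * v b" l] b \<theta> by (simp add: echar_nonzero)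
qed

text \<open>Distinct frequencies may restrict to the same function on \<open>A\<close>. Prescribing
  the eigenvalue \<open>echar l t\<close> on all of the group selects at most one frequency for each
  such function.\<close>

definition spectrum :: "(real^'n) set" where
  "spectrum = {l. \<forall>t. U t (erestr A l) = (\<lambda>x. echar l t * erestr A l x)}"

text \<open>Applying \<open>U t\<close> to both exponentials preserves their inner product but also
  multiplies it by \<open>echar l t * cnj (echar m t)\<close>, which differs from 1 for a suitable
  \<open>t\<close>.\<close>

lemma orth_spectrum:
  "\<forall>l\<in>spectrum. \<forall>m\<in>spectrum. l \<noteq> m \<longrightarrow> l2inner A (erestr A l) (erestr A m) = 0"
proof (intro ballI impI)
  fix l m assume "l \<in> spectrum" "m \<in> spectrum" "l \<noteq> m"
  obtain t where t: "echar l t * cnj (echar m t) \<noteq> 1"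
    using echar_separates[OF \<open>l \<noteq> m\<close>] by blast
  have "l2inner A (erestr A l) (erestr A m)
      = l2inner A (U t (erestr A l)) (U t (erestr A m))"
    by (simp add: l2inner_U erestr_in_L2)
  also have "\<dots> = echar l t * cnj (echar m t) * l2inner A (erestr A l) (erestr A m)"
    using \<open>l \<in> spectrum\<close> \<open>m \<in> spectrum\<close>
    by (simp add: spectrum_def l2inner_scale_left l2inner_scale_right mult.assoc)
  finally show "l2inner A (erestr A l) (erestr A m) = 0" using t by simp
qed

lemma orthfam_spectrum: "orthfam A spectrum (erestr A)"
  by (rule orthfam_erestr[OF fin ne orth_spectrum])

lemma finite_spectrum: "finite spectrum"
proof (rule finite_if_finite_subsets_card_bdd[THEN conjunct1])
  fix G assume "G \<subseteq> spectrum" "finite G"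
  then have "orthfam A G (erestr A)" using orthfam_spectrum unfolding orthfam_def by blast
  then show "card G \<le> card A" using orthfam_card_le[OF fin] \<open>finite G\<close> by blast
qed

text \<open>The orthogonal complement of the exponentials is invariant under the group. Were it
  nonzero, it would contain a joint eigenvector, hence an exponential from \<open>spectrum\<close>
  orthogonal to itself.\<close>

lemma spectrum_complete:
  assumes f: "f \<in> L2 A" and perp: "\<And>l. l \<in> spectrum \<Longrightarrow> l2inner A f (erestr A l) = 0"
  shows "f = (\<lambda>x. 0)"
proof (rule ccontr)
  assume f0: "f \<noteq> (\<lambda>x. 0)"
  define V where "V = {g \<in> L2 A. \<forall>l\<in>spectrum. l2inner A g (erestr A l) = 0}"
  have "V \<subseteq> L2 A" by (auto simp: V_def)
  have V: "csubspace A V"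
    using csubspace_L2[of A] unfolding csubspace_def V_def
    by (auto simp: l2inner_add_scale_left l2inner_zero_left)
  have inv: "U t g \<in> V" if "g \<in> V" for t g
  proof -
    have "l2inner A (U t g) (erestr A l) = 0" if l: "l \<in> spectrum" for l
    proof -
      have "cnj (echar l t) * l2inner A (U t g) (erestr A l) = l2inner A (U t g) (U t (erestr A l))"
        using l by (simp add: spectrum_def l2inner_scale_right)
      also have "\<dots> = 0" using \<open>g \<in> V\<close> l by (simp add: l2inner_U erestr_in_L2 V_def)
      finally show ?thesis by (simp add: echar_nonzero)
    qed
    then show ?thesis using that by (simp add: V_def U_in_L2)
  qed
  have lin: "clinear_on V (U t)" for t
    using U_linear[of t] \<open>V \<subseteq> L2 A\<close> unfolding clinear_on_def by blast
  have comm: "U s (U t g) = U t (U s g)" if "g \<in> V" for s t g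
    using group[of g s t] group[of g t s] that by (simp add: V_def add.commute)
  have "f \<in> V" using f perp by (simp add: V_def)
  obtain v \<theta> where v: "v \<in> V" "v \<noteq> (\<lambda>x. 0)" "\<And>t. U t v = (\<lambda>x. \<theta> t * v x)"
    by (rule joint_eigenvector_exists[where U = U, OF fin V \<open>f \<in> V\<close> f0 lin inv comm])
      (assumption | rule that)+
  then have "v \<in> L2 A" by (simp add: V_def)
  then obtain l C where lC: "C \<noteq> 0" "v = (\<lambda>x. C * erestr A l x)" "\<And>t. \<theta> t = echar l t"
    using joint_eigenvector_eq_exponential[of v \<theta>] v by blast
  have e: "erestr A l = (\<lambda>x. inverse C * v x)" using lC(1,2) by (simp add: mult.assoc[symmetric])
  have "U t (erestr A l) = (\<lambda>x. echar l t * erestr A l x)" for t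
    unfolding e using U_scale[OF \<open>v \<in> L2 A\<close>, of t "inverse C"] by (simp add: v(3) lC(3) mult.left_commute)
  then have "l \<in> spectrum" by (simp add: spectrum_def)
  then have "C * l2inner A (erestr A l) (erestr A l) = 0"
    using v(1) lC(2) by (auto simp: V_def l2inner_scale_left)
  then show False using lC(1) l2inner_erestr_self[OF fin ne, of l] by simp
qed

lemma spectral: "spectral A"
  unfolding spectral_def
proof (rule exI[of _ spectrum], rule conjI[OF orth_spectrum], rule ballI)
  fix f assume f: "f \<in> L2 A"
  obtain c where c: "\<And>l. l \<in> spectrum \<Longrightarrow>
      l2inner A (\<lambda>x. f x + (-1) * (\<Sum>m\<in>spectrum. c m * erestr A m x)) (erestr A l) = 0"
    using orthfam_residual[OF fin orthfam_spectrum finite_spectrum, of f] by blast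
  have "(\<lambda>x. f x + (-1) * (\<Sum>m\<in>spectrum. c m * erestr A m x)) \<in> L2 A"
    by (intro csubspace_add_scale[OF csubspace_L2 f] csubspace_sum[OF csubspace_L2] erestr_in_L2)
  \<comment> \<open>The residual is orthogonal to every exponential in \<open>spectrum\<close>, so
    it is zero and \<open>f\<close> equals its projection.\<close>
  from spectrum_complete[OF this c] have "f = (\<lambda>x. \<Sum>m\<in>spectrum. c m * erestr A m x)"
    by (simp add: fun_eq_iff)
  then show "\<exists>S c. finite S \<and> S \<subseteq> spectrum \<and> f = (\<lambda>x. \<Sum>m\<in>S. c m * erestr A m x)"
    using finite_spectrum by blast
qed

end

section \<open>The two constructions combined into the equivalence\<close>

theorem theorem2p6:
  fixes A :: "(real^'n) set"
  assumes "finite A"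
  shows "spectral A \<longleftrightarrow>
    (\<exists>U :: real^'n \<Rightarrow> ((real^'n \<Rightarrow> complex) \<Rightarrow> (real^'n \<Rightarrow> complex)).
       (\<forall>t. unitary_on A (U t)) \<and>
       (\<forall>f\<in>L2 A. \<forall>x. continuous_on UNIV (\<lambda>t. U t f x)) \<and>
       (\<forall>t s. \<forall>f\<in>L2 A. U (t + s) f = U t (U s f)) \<and>
       (\<forall>a\<in>A. \<forall>a'\<in>A. U (a - a') (chi a) = chi a'))" (is "_ \<longleftrightarrow> (\<exists>U. ?G U)")
proof (cases "A = {}")
  \<comment> \<open>Normalizing the exponentials divides by \<open>card A\<close>, so the empty set
    is treated apart: \<open>L2 A\<close> holds only the zero function, the empty spectrum spans it,
    and the identity operators form the group.\<close>
  case True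
  have "spectral A"
    unfolding spectral_def by (intro exI[of _ "{}"]) (auto simp: True L2_def)
  moreover have "?G (\<lambda>t f. f)" by (auto simp: True unitary_on_def)
  ultimately show ?thesis by (intro iffI exI[of _ "\<lambda>t f. f"])
next
  case False
  show ?thesis
  proof
    assume "spectral A"
    then obtain S where "finite S"
      "\<forall>l\<in>S. \<forall>m\<in>S. l \<noteq> m \<longrightarrow> l2inner A (erestr A l) (erestr A m) = 0"
      "\<And>f. f \<in> L2 A \<Longrightarrow> \<exists>c. f = (\<lambda>x. \<Sum>m\<in>S. c m * erestr A m x)"
      by (rule spectral_imp_finite_spectrum[OF assms]) blast
    then interpret finite_spectrum A S using assms False by unfold_locales
    have "?G (modulate A S)"
      using unitary_on_modulate continuous_on_modulate modulate_add modulate_chi by blast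
    then show "\<exists>U. ?G U" by blast
  next
    assume "\<exists>U. ?G U"
    then obtain U where "?G U" by blast
    then interpret unitary_group A U
      by (unfold_locales; (use assms False in blast)?)
    show "spectral A" by (rule spectral)
  qed
qed

end
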